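(* Let $G$ be a finite non-trivial group and let $H\leq G$ be a normal subgroup. Then there exists a finite incidence system $\Gamma$ such that: (1) every vertex in the incidence graph of $\Gamma$ has degree at least $2$; (2) all cliques in the incidence graph of $\Gamma$ have rank at most $2$; (3) the pair $(\operatorname{Aut}(\Gamma),\operatorname{Aut}_I(\Gamma))$ is isomorphic to the pair $(G,H)$, i.e. there is a group isomorphism $\varphi\colon \operatorname{Aut}(\Gamma)\to G$ with $\varphi(\operatorname{Aut}_I(\Gamma))=H$.
   Context: An incidence system is a tuple $\Gamma=(X,\ast,t,I)$ where $X$ is a non-empty set (of elements), $I$ is a finite set (of types), $t\colon X\to I$ is a surjective map (the type function), and $\ast$ is a symmetric binary relation on $X$ (the incidence relation) such that for all $x,y\in X$, if $x\neq y$ and $x\ast y$, then $t(x)\neq t(y)$. By convention, an element is not incident to itself. $\Gamma$ is finite if $X$ is finite. The incidence graph of $\Gamma$ is the simple graph with vertex set $X$, properly colored by $t$ with palette $I$, in which $\{x,y\}$ is an edge if and only if $x\ast y$. The rank of a clique (a set of pairwise adjacent vertices) is its number of vertices. A correlation of $\Gamma$ is a permutation $f$ of $X$ such that for all $x,y\in X$: $x\ast y\Leftrightarrow f(x)\ast f(y)$, and $t(x)=t(y)\Leftrightarrow t(f(x))=t(f(y))$. An automorphism of $\Gamma$ is a correlation $f$ with $t(f(x))=t(x)$ for all $x\in X$. $\operatorname{Aut}(\Gamma)$ denotes the group of all correlations of $\Gamma$ under composition, and $\operatorname{Aut}_I(\Gamma)$ denotes its normal subgroup consisting of the automorphisms of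 $\Gamma$. *)

theory Defs
  imports "HOL-Algebra.Bij" "HOL-Algebra.Coset" "HOL-Library.Ramsey"
begin

section \<open>Incidence systems\<close>

record ('x, 'i) inc_system =
  elems :: "'x set"
  incid :: "'x rel"
  typ_of :: "'x \<Rightarrow> 'i"
  typs :: "'i set"

locale incidence_system =
  fixes \<Gamma> :: "('x, 'i) inc_system" (structure)
  assumes elems_nonempty: "elems \<Gamma> \<noteq> {}"
    and finite_typs: "finite (typs \<Gamma>)"
    and typ_of_surj: "typ_of \<Gamma> ` elems \<Gamma> = typs \<Gamma>"
    and incid_subset: "incid \<Gamma> \<subseteq> elems \<Gamma> \<times> elems \<Gamma>"
    and incid_sym: "sym (incid \<Gamma>)"
    and incid_irrefl: "irrefl (incid \<Gamma>)"
    and incid_typ_of: "\<lbrakk>x \<in> elems \<Gamma>; y \<in> elems \<Gamma>; x \<noteq> y; (x, y) \<in> incid \<Gamma>\<rbrakk>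
      \<Longrightarrow> typ_of \<Gamma> x \<noteq> typ_of \<Gamma> y"

locale finite_incidence_system = incidence_system +
  assumes finite_elems: "finite (elems \<Gamma>)"


section \<open>The incidence graph\<close>

text \<open>The vertex set of the incidence graph is \<^term>\<open>elems \<Gamma>\<close>; edges are two-element sets, as
  expected by \<^const>\<open>clique\<close>.\<close>

definition incidence_edges :: "('x, 'i) inc_system \<Rightarrow> 'x set set" where
  "incidence_edges \<Gamma> =
    {{x, y} | x y. x \<in> elems \<Gamma> \<and> y \<in> elems \<Gamma> \<and> (x, y) \<in> incid \<Gamma>}"

text \<open>Only meaningful if finitely many edges contain \<^term>\<open>v\<close> (\<^const>\<open>card\<close> is 0 otherwise).\<close>

definition vertex_degree :: "'x set set \<Rightarrow> 'x \<Rightarrow> nat" where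
  "vertex_degree E v = card {e \<in> E. v \<in> e}"


section \<open>Correlations and automorphisms\<close>

text \<open>As in \<^const>\<open>BijGroup\<close>, permutations of \<^term>\<open>elems \<Gamma>\<close> are extensional functions
  (\<^const>\<open>undefined\<close> outside \<^term>\<open>elems \<Gamma>\<close>), so that each permutation is represented once.\<close>

definition correlations :: "('x, 'i) inc_system \<Rightarrow> ('x \<Rightarrow> 'x) set" where
  "correlations \<Gamma> = {f \<in> Bij (elems \<Gamma>).
     \<forall>x \<in> elems \<Gamma>. \<forall>y \<in> elems \<Gamma>.
       ((x, y) \<in> incid \<Gamma> \<longleftrightarrow> (f x, f y) \<in> incid \<Gamma>) \<and>
       (typ_of \<Gamma> x = typ_of \<Gamma> y \<longleftrightarrow> typ_of \<Gamma> (f x) = typ_of \<Gamma> (f y))}"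

definition automorphisms :: "('x, 'i) inc_system \<Rightarrow> ('x \<Rightarrow> 'x) set" where
  "automorphisms \<Gamma> = {f \<in> correlations \<Gamma>. \<forall>x \<in> elems \<Gamma>. typ_of \<Gamma> (f x) = typ_of \<Gamma> x}"

definition Aut :: "('x, 'i) inc_system \<Rightarrow> ('x \<Rightarrow> 'x) monoid" where
  "Aut \<Gamma> = (BijGroup (elems \<Gamma>))\<lparr>carrier := correlations \<Gamma>\<rparr>"

lemma Bij_mem: "f \<in> Bij S \<Longrightarrow> x \<in> S \<Longrightarrow> f x \<in> S"
  using Bij_imp_funcset by blast

lemma BijGroup_mult_apply:
  "\<lbrakk>f \<in> Bij S; g \<in> Bij S; x \<in> S\<rbrakk> \<Longrightarrow> (f \<otimes>\<^bsub>BijGroup S\<^esub> g) x = f (g x)"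
  by (simp add: BijGroup_def compose_def)

lemma BijGroup_inv_apply:
  assumes "f \<in> Bij S" "x \<in> S"
  shows "f ((inv\<^bsub>BijGroup S\<^esub> f) x) = x" and "(inv\<^bsub>BijGroup S\<^esub> f) (f x) = x"
    and "inv\<^bsub>BijGroup S\<^esub> f \<in> Bij S"
proof -
  interpret B: group "BijGroup S" by (rule group_BijGroup)
  have c: "carrier (BijGroup S) = Bij S" and o: "\<one>\<^bsub>BijGroup S\<^esub> = (\<lambda>x\<in>S. x)"
    by (simp_all add: BijGroup_def)
  show i: "inv\<^bsub>BijGroup S\<^esub> f \<in> Bij S"
    using B.inv_closed assms(1) c by blast
  show "f ((inv\<^bsub>BijGroup S\<^esub> f) x) = x"
    using BijGroup_mult_apply[OF assms(1) i assms(2)] B.r_inv[of f] assms c o by simp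
  show "(inv\<^bsub>BijGroup S\<^esub> f) (f x) = x"
    using BijGroup_mult_apply[OF i assms(1) assms(2)] B.l_inv[of f] assms c o by simp
qed

lemma subgroup_correlations: "subgroup (correlations \<Gamma>) (BijGroup (elems \<Gamma>))"
proof -
  let ?S = "elems \<Gamma>"
  interpret B: group "BijGroup ?S" by (rule group_BijGroup)
  have c: "carrier (BijGroup ?S) = Bij ?S" by (simp add: BijGroup_def)
  show ?thesis
  proof (rule B.subgroupI)
    show "correlations \<Gamma> \<subseteq> carrier (BijGroup ?S)"
      by (auto simp: c correlations_def)
    show "correlations \<Gamma> \<noteq> {}"
      using id_Bij[of ?S] by (force simp: correlations_def)
  next
    fix f assume f: "f \<in> correlations \<Gamma>"
    then have fB: "f \<in> Bij ?S" by (simp add: correlations_def)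
    let ?g = "inv\<^bsub>BijGroup ?S\<^esub> f"
    have gB: "?g \<in> Bij ?S"
      using B.inv_closed fB c by blast
    have "f (?g x) = x \<and> ?g x \<in> ?S" if "x \<in> ?S" for x
      using BijGroup_inv_apply(1)[OF fB that] Bij_mem[OF gB that] by simp
    then show "?g \<in> correlations \<Gamma>"
      using f gB by (simp add: correlations_def)
  next
    fix f g assume f: "f \<in> correlations \<Gamma>" and g: "g \<in> correlations \<Gamma>"
    then have fB: "f \<in> Bij ?S" and gB: "g \<in> Bij ?S" by (simp_all add: correlations_def)
    have "f \<otimes>\<^bsub>BijGroup ?S\<^esub> g \<in> Bij ?S"
      using B.m_closed fB gB c by blast
    then show "f \<otimes>\<^bsub>BijGroup ?S\<^esub> g \<in> correlations \<Gamma>"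
      using f g Bij_mem[OF gB] by (simp add: correlations_def BijGroup_mult_apply[OF fB gB])
  qed
qed

lemma group_Aut: "group (Aut \<Gamma>)"
  unfolding Aut_def
  using subgroup.subgroup_is_group[OF subgroup_correlations group_BijGroup] .

lemma Aut_apply:
  assumes "f \<in> correlations \<Gamma>" "x \<in> elems \<Gamma>"
  shows "g \<in> correlations \<Gamma> \<Longrightarrow> (f \<otimes>\<^bsub>Aut \<Gamma>\<^esub> g) x = f (g x)"
    and "f ((inv\<^bsub>Aut \<Gamma>\<^esub> f) x) = x"
proof -
  have "inv\<^bsub>Aut \<Gamma>\<^esub> f = inv\<^bsub>BijGroup (elems \<Gamma>)\<^esub> f"
    unfolding Aut_def
    using group.m_inv_consistent[OF group_BijGroup subgroup_correlations assms(1)] .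
  then show "f ((inv\<^bsub>Aut \<Gamma>\<^esub> f) x) = x"
    using BijGroup_inv_apply(1)[of f "elems \<Gamma>" x] assms by (simp add: correlations_def)
  show "(f \<otimes>\<^bsub>Aut \<Gamma>\<^esub> g) x = f (g x)" if "g \<in> correlations \<Gamma>"
    using BijGroup_mult_apply[of f "elems \<Gamma>" g x] that assms
    by (simp add: Aut_def correlations_def)
qed

lemma automorphisms_normal: "automorphisms \<Gamma> \<lhd> Aut \<Gamma>"
proof -
  interpret A: group "Aut \<Gamma>" by (rule group_Aut)
  have c: "carrier (Aut \<Gamma>) = correlations \<Gamma>" by (simp add: Aut_def)
  have mem: "f x \<in> elems \<Gamma>" if "f \<in> correlations \<Gamma>" "x \<in> elems \<Gamma>" for f x
    using that Bij_mem by (force simp: correlations_def)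
  have cinv: "inv\<^bsub>Aut \<Gamma>\<^esub> f \<in> correlations \<Gamma>" if "f \<in> correlations \<Gamma>" for f
    using A.inv_closed that c by blast
  have cmult: "f \<otimes>\<^bsub>Aut \<Gamma>\<^esub> g \<in> correlations \<Gamma>"
    if "f \<in> correlations \<Gamma>" "g \<in> correlations \<Gamma>" for f g
    using A.m_closed that c by blast
  have same_typ: "typ_of \<Gamma> (f x) = typ_of \<Gamma> (f y)"
    if "f \<in> correlations \<Gamma>" "x \<in> elems \<Gamma>" "y \<in> elems \<Gamma>" "typ_of \<Gamma> x = typ_of \<Gamma> y" for f x y
    using that by (simp add: correlations_def)
  have auto: "f \<in> correlations \<Gamma>" "\<And>x. x \<in> elems \<Gamma> \<Longrightarrow> typ_of \<Gamma> (f x) = typ_of \<Gamma> x"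
    if "f \<in> automorphisms \<Gamma>" for f
    using that by (simp_all add: automorphisms_def)
  show ?thesis
  proof (rule A.normal_invI)
    show "subgroup (automorphisms \<Gamma>) (Aut \<Gamma>)"
    proof (rule A.subgroupI)
      show "automorphisms \<Gamma> \<subseteq> carrier (Aut \<Gamma>)"
        by (auto simp: c automorphisms_def)
      have "(\<lambda>x\<in>elems \<Gamma>. x) \<in> automorphisms \<Gamma>"
        using id_Bij[of "elems \<Gamma>"] by (simp add: automorphisms_def correlations_def)
      then show "automorphisms \<Gamma> \<noteq> {}" by blast
    next
      fix f assume f: "f \<in> automorphisms \<Gamma>"
      have "typ_of \<Gamma> ((inv\<^bsub>Aut \<Gamma>\<^esub> f) x) = typ_of \<Gamma> x" if x: "x \<in> elems \<Gamma>" for x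
        using auto(2)[OF f mem[OF cinv[OF auto(1)[OF f]] x]] Aut_apply(2)[OF auto(1)[OF f] x]
        by simp
      then show "inv\<^bsub>Aut \<Gamma>\<^esub> f \<in> automorphisms \<Gamma>"
        using cinv[OF auto(1)[OF f]] by (simp add: automorphisms_def)
    next
      fix f g assume f: "f \<in> automorphisms \<Gamma>" and g: "g \<in> automorphisms \<Gamma>"
      have "typ_of \<Gamma> ((f \<otimes>\<^bsub>Aut \<Gamma>\<^esub> g) x) = typ_of \<Gamma> x" if x: "x \<in> elems \<Gamma>" for x
        using Aut_apply(1)[OF auto(1)[OF f] x auto(1)[OF g]]
          auto(2)[OF f mem[OF auto(1)[OF g] x]] auto(2)[OF g x] by simp
      then show "f \<otimes>\<^bsub>Aut \<Gamma>\<^esub> g \<in> automorphisms \<Gamma>"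
        using cmult[OF auto(1)[OF f] auto(1)[OF g]] by (simp add: automorphisms_def)
    qed
  next
    fix f h assume "f \<in> carrier (Aut \<Gamma>)" and h: "h \<in> automorphisms \<Gamma>"
    then have f: "f \<in> correlations \<Gamma>" by (simp add: c)
    let ?g = "inv\<^bsub>Aut \<Gamma>\<^esub> f"
    have "typ_of \<Gamma> ((f \<otimes>\<^bsub>Aut \<Gamma>\<^esub> h \<otimes>\<^bsub>Aut \<Gamma>\<^esub> ?g) x) = typ_of \<Gamma> x" if x: "x \<in> elems \<Gamma>" for x
    proof -
      have gx: "?g x \<in> elems \<Gamma>" using mem[OF cinv[OF f] x] .
      have "(f \<otimes>\<^bsub>Aut \<Gamma>\<^esub> h \<otimes>\<^bsub>Aut \<Gamma>\<^esub> ?g) x = f (h (?g x))"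
        using Aut_apply(1)[OF cmult[OF f auto(1)[OF h]] x cinv[OF f]]
          Aut_apply(1)[OF f gx auto(1)[OF h]] by simp
      also have "typ_of \<Gamma> \<dots> = typ_of \<Gamma> (f (?g x))"
        using same_typ[OF f mem[OF auto(1)[OF h] gx] gx auto(2)[OF h gx]] .
      finally show ?thesis using Aut_apply(2)[OF f x] by simp
    qed
    then show "f \<otimes>\<^bsub>Aut \<Gamma>\<^esub> h \<otimes>\<^bsub>Aut \<Gamma>\<^esub> ?g \<in> automorphisms \<Gamma>"
      using cmult[OF cmult[OF f auto(1)[OF h]] cinv[OF f]] by (simp add: automorphisms_def)
  qed
qed

end

theory Submission
  imports Defs
begin

text \<open>
  Frucht's construction, with the types doing part of the rigidifying. Take two copies
  \<open>B\<close>, \<open>C\<close> of \<open>G\<close>, a vertex \<open>U g a\<close> adjacent to \<open>B g\<close> and \<open>C (g a)\<close> for every arc of the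
  Cayley graph, and fixed vertices \<open>W j\<close> adjacent to those \<open>U g a\<close> whose label \<open>a\<close> has number
  at least \<open>j\<close>, so that the degree of \<open>U g a\<close> reveals \<open>a\<close>. All \<open>U g a\<close> have one type, all
  \<open>C g\<close> and \<open>W j\<close> have a second one, and \<open>B g\<close> is typed by the coset of \<open>g\<close> modulo \<open>H\<close>. The
  type classes have sizes \<open>n\<^sup>2 > 2 n - 1 > n \<ge> \<bar>H\<bar>\<close> with \<open>n = \<bar>G\<bar> > 1\<close>, hence a correlation respects
  the kinds of vertices, and following the arcs shows that it is a left translation. It fixes
  all types iff it translates by an element of \<open>H\<close>.
\<close>

section \<open>Incidence systems from group actions\<close>

text \<open>Sending a neighbour \<open>w\<close> to \<open>{v, w}\<close> is a bijection onto the
  edges through \<open>v\<close>, so degrees can be computed from the relation itself.\<close>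

lemma vertex_degree_incidence_edges:
  assumes "incid \<Gamma> \<subseteq> elems \<Gamma> \<times> elems \<Gamma>" and "sym (incid \<Gamma>)"
  shows "vertex_degree (incidence_edges \<Gamma>) v = card (incid \<Gamma> `` {v})"
proof -
  have "{e \<in> incidence_edges \<Gamma>. v \<in> e} = (\<lambda>w. {v, w}) ` (incid \<Gamma> `` {v})"
    using assms unfolding incidence_edges_def sym_def by auto
  moreover have "inj_on (\<lambda>w. {v, w}) (incid \<Gamma> `` {v})"
    by (auto simp: inj_on_def doubleton_eq_iff)
  ultimately show ?thesis
    by (simp add: vertex_degree_def card_image)
qed

text \<open>Three vertices of a larger clique would form a triangle. An infinite \<open>K\<close>
  satisfies the bound through the default \<open>card K = 0\<close>.\<close>

lemma triangle_free_clique_card_le_2: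
  assumes "sym (incid \<Gamma>)"
    and "\<And>x y z. \<lbrakk>(x, y) \<in> incid \<Gamma>; (y, z) \<in> incid \<Gamma>; (x, z) \<in> incid \<Gamma>\<rbrakk> \<Longrightarrow> False"
    and "clique K (incidence_edges \<Gamma>)"
  shows "card K \<le> 2"
proof (rule ccontr)
  assume "\<not> card K \<le> 2"
  then have "3 \<le> card K" by simp
  then obtain T where T: "T \<subseteq> K" "card T = 3"
    by (metis obtain_subset_with_card_n)
  then obtain x y z where "T = {x, y, z}" "x \<noteq> y" "y \<noteq> z" "x \<noteq> z"
    by (auto simp: card_3_iff)
  moreover have "(p, q) \<in> incid \<Gamma>" if "p \<in> K" "q \<in> K" "p \<noteq> q" for p q
    using assms(1,3) that unfolding clique_def incidence_edges_def sym_def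
    by (fastforce simp: doubleton_eq_iff)
  ultimately show False
    using assms(2)[of x y z] T(1) by auto
qed

text \<open>Separates the bookkeeping from the combinatorics: what remains is to find a typed
  triangle-free graph with a faithful action of \<open>G\<close>. The demanding hypothesis is
  \<open>full\<close>: every permutation preserving adjacency and equality of types comes from the
  action.\<close>

lemma realize_action:
  fixes G :: "('a, 'b) monoid_scheme" (structure) and V :: "'v set" and E :: "'v rel" and \<tau> :: "'v \<Rightarrow> 't"
    and act :: "'a \<Rightarrow> 'v \<Rightarrow> 'v"
  assumes "group G"
    and V: "finite V" "V \<noteq> {}"
    and E: "E \<subseteq> V \<times> V" "sym E"
    and proper: "\<And>x y. (x, y) \<in> E \<Longrightarrow> \<tau> x \<noteq> \<tau> y"
    and degree: "\<And>x. x \<in> V \<Longrightarrow> 2 \<le> card (E `` {x})"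
    and triangle_free: "\<And>x y z. \<lbrakk>(x, y) \<in> E; (y, z) \<in> E; (x, z) \<in> E\<rbrakk> \<Longrightarrow> False"
    and act_closed: "\<And>g x. \<lbrakk>g \<in> carrier G; x \<in> V\<rbrakk> \<Longrightarrow> act g x \<in> V"
    and act_one: "\<And>x. x \<in> V \<Longrightarrow> act \<one>\<^bsub>G\<^esub> x = x"
    and act_mult: "\<And>g h x. \<lbrakk>g \<in> carrier G; h \<in> carrier G; x \<in> V\<rbrakk>
      \<Longrightarrow> act (g \<otimes>\<^bsub>G\<^esub> h) x = act g (act h x)"
    and act_faithful: "\<And>g. \<lbrakk>g \<in> carrier G; \<forall>x \<in> V. act g x = x\<rbrakk> \<Longrightarrow> g = \<one>\<^bsub>G\<^esub>"
    and act_E: "\<And>g x y. \<lbrakk>g \<in> carrier G; (x, y) \<in> E\<rbrakk> \<Longrightarrow> (act g x, act g y) \<in> E"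
    and act_typ: "\<And>g x y. \<lbrakk>g \<in> carrier G; x \<in> V; y \<in> V; \<tau> x = \<tau> y\<rbrakk>
      \<Longrightarrow> \<tau> (act g x) = \<tau> (act g y)"
    and act_kernel: "\<And>g. g \<in> carrier G \<Longrightarrow> (\<forall>x \<in> V. \<tau> (act g x) = \<tau> x) \<longleftrightarrow> g \<in> H"
    and "H \<subseteq> carrier G"
    and full: "\<And>f. \<lbrakk>bij_betw f V V;
        \<And>x y. \<lbrakk>x \<in> V; y \<in> V\<rbrakk> \<Longrightarrow> (x, y) \<in> E \<longleftrightarrow> (f x, f y) \<in> E;
        \<And>x y. \<lbrakk>x \<in> V; y \<in> V\<rbrakk> \<Longrightarrow> \<tau> x = \<tau> y \<longleftrightarrow> \<tau> (f x) = \<tau> (f y)\<rbrakk>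
      \<Longrightarrow> \<exists>g \<in> carrier G. \<forall>x \<in> V. f x = act g x"
  shows "\<exists>\<Gamma> :: (nat, nat) inc_system.
    finite_incidence_system \<Gamma> \<and>
    (\<forall>v \<in> elems \<Gamma>. vertex_degree (incidence_edges \<Gamma>) v \<ge> 2) \<and>
    (\<forall>K \<subseteq> elems \<Gamma>. clique K (incidence_edges \<Gamma>) \<longrightarrow> card K \<le> 2) \<and>
    (\<exists>\<phi> \<in> iso (Aut \<Gamma>) G. \<phi> ` automorphisms \<Gamma> = H)"
proof -
  interpret group G by fact
  \<comment> \<open>Vertices and types are renamed to natural numbers; \<open>c\<close> is injective
    on the types that occur, so equality of types survives.\<close>
  obtain e :: "'v \<Rightarrow> nat" where e: "inj_on e V"
    using finite_imp_inj_to_nat_seg[OF V(1)] by blast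
  obtain c :: "'t \<Rightarrow> nat" where c: "inj_on c (\<tau> ` V)"
    using finite_imp_inj_to_nat_seg[of "\<tau> ` V"] V(1) by blast
  define d where "d = inv_into V e"
  have de [simp]: "d (e x) = x" if "x \<in> V" for x
    using e that by (simp add: d_def)
  define \<Gamma> :: "(nat, nat) inc_system" where
    "\<Gamma> = \<lparr>elems = e ` V, incid = map_prod e e ` E, typ_of = c \<circ> \<tau> \<circ> d, typs = c ` \<tau> ` V\<rparr>"
  have elems [simp]: "elems \<Gamma> = e ` V"
    by (simp add: \<Gamma>_def)
  have incid: "(e x, e y) \<in> incid \<Gamma> \<longleftrightarrow> (x, y) \<in> E" if "x \<in> V" "y \<in> V" for x y
  proof
    assume "(e x, e y) \<in> incid \<Gamma>"
    then obtain x' y' where "(x', y') \<in> E" "e x = e x'" "e y = e y'"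
      by (auto simp: \<Gamma>_def)
    then show "(x, y) \<in> E"
      using that e E(1) by (metis SigmaD1 SigmaD2 inj_onD subsetD)
  qed (force simp: \<Gamma>_def)
  have incidE: "\<exists>x y. p = e x \<and> q = e y \<and> x \<in> V \<and> y \<in> V \<and> (x, y) \<in> E"
    if "(p, q) \<in> incid \<Gamma>" for p q
    using that E(1) by (auto simp: \<Gamma>_def)
  have typ_iff: "typ_of \<Gamma> (e x) = typ_of \<Gamma> (e y) \<longleftrightarrow> \<tau> x = \<tau> y" if "x \<in> V" "y \<in> V" for x y
    using that c by (auto simp: \<Gamma>_def inj_on_def)
  have sub: "incid \<Gamma> \<subseteq> elems \<Gamma> \<times> elems \<Gamma>"
    using E(1) by (auto simp: \<Gamma>_def)
  have sym: "sym (incid \<Gamma>)"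
    using E(2) by (auto simp: \<Gamma>_def sym_def)
  have proper': "typ_of \<Gamma> p \<noteq> typ_of \<Gamma> q" if "(p, q) \<in> incid \<Gamma>" for p q
    using incidE[OF that] typ_iff proper by auto
  have "finite_incidence_system \<Gamma>"
  proof
    show "typ_of \<Gamma> ` elems \<Gamma> = typs \<Gamma>"
      by (force simp: \<Gamma>_def image_iff)
    show "irrefl (incid \<Gamma>)"
      using proper' by (auto simp: irrefl_def)
    show "finite (typs \<Gamma>)"
      using V by (simp add: \<Gamma>_def)
  qed (use V sub sym proper' in auto)
  moreover have "\<forall>v \<in> elems \<Gamma>. vertex_degree (incidence_edges \<Gamma>) v \<ge> 2"
  proof
    fix v assume "v \<in> elems \<Gamma>"
    then obtain x where x: "v = e x" "x \<in> V" by auto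
    have "incid \<Gamma> `` {v} = e ` (E `` {x})"
    proof
      show "incid \<Gamma> `` {v} \<subseteq> e ` (E `` {x})"
        using x e by (auto dest!: incidE simp: inj_on_def)
      show "e ` (E `` {x}) \<subseteq> incid \<Gamma> `` {v}"
        using x by (auto simp: \<Gamma>_def)
    qed
    moreover have "inj_on e (E `` {x})"
      using e E(1) by (auto intro: inj_on_subset)
    ultimately show "vertex_degree (incidence_edges \<Gamma>) v \<ge> 2"
      using vertex_degree_incidence_edges[OF sub sym] degree[OF x(2)] by (simp add: card_image)
  qed
  moreover have "\<forall>K \<subseteq> elems \<Gamma>. clique K (incidence_edges \<Gamma>) \<longrightarrow> card K \<le> 2"
  proof (intro allI impI)
    fix K assume "clique K (incidence_edges \<Gamma>)"
    then show "card K \<le> 2"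
    proof (rule triangle_free_clique_card_le_2[OF sym, rotated])
      fix p q r assume *: "(p, q) \<in> incid \<Gamma>" "(q, r) \<in> incid \<Gamma>" "(p, r) \<in> incid \<Gamma>"
      then obtain x y z where "p = e x" "q = e y" "r = e z" "x \<in> V" "y \<in> V" "z \<in> V"
        by (metis incidE)
      then show False
        using * incid triangle_free by blast
    qed
  qed
  moreover have "\<exists>\<phi> \<in> iso (Aut \<Gamma>) G. \<phi> ` automorphisms \<Gamma> = H"
  proof -
    define \<psi> where "\<psi> g = (\<lambda>p \<in> e ` V. e (act g (d p)))" for g
    have \<psi> [simp]: "\<psi> g (e x) = e (act g x)" if "x \<in> V" for g x
      using that by (simp add: \<psi>_def)
    have act_inv: "act (inv g) (act g x) = x" "act g (act (inv g) x) = x"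
      if "g \<in> carrier G" "x \<in> V" for g x
      using that act_mult[of "inv g" g x] act_mult[of g "inv g" x] act_one by simp_all
    have \<psi>_cor: "\<psi> g \<in> correlations \<Gamma>" if g: "g \<in> carrier G" for g
    proof -
      have "bij_betw (\<psi> g) (e ` V) (e ` V)"
        by (rule bij_betw_byWitness[where f' = "\<psi> (inv g)"])
          (use g act_closed act_inv in auto)
      moreover have "(x, y) \<in> E \<longleftrightarrow> (act g x, act g y) \<in> E" if "x \<in> V" "y \<in> V" for x y
        \<comment> \<open>Adjacency is only assumed to be preserved in one direction; acting by
          \<open>inv g\<close> gives the converse. The same holds for types below.\<close>
        using act_E[OF g, of x y] act_E[of "inv g" "act g x" "act g y"] act_inv g that by auto
      moreover have "\<tau> x = \<tau> y \<longleftrightarrow> \<tau> (act g x) = \<tau> (act g y)" if "x \<in> V" "y \<in> V" for x y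
        using act_typ[OF g, of x y] act_typ[of "inv g" "act g x" "act g y"]
          act_closed[OF g] act_inv g that by auto
      ultimately show ?thesis
        using act_closed[OF g]
        by (auto simp: correlations_def Bij_def incid typ_iff) (simp add: \<psi>_def)
    qed
    have surj: "\<exists>g \<in> carrier G. f = \<psi> g" if f: "f \<in> correlations \<Gamma>" for f
    proof -
      have bij: "bij_betw f (e ` V) (e ` V)" and ext: "f \<in> extensional (e ` V)"
        using f by (auto simp: correlations_def Bij_def)
      have be: "bij_betw e V (e ` V)" and bd: "bij_betw d (e ` V) V"
        unfolding d_def using e by (auto simp: inj_on_imp_bij_betw bij_betw_inv_into)
      have fx: "\<exists>y \<in> V. f (e x) = e y" if "x \<in> V" for x
        using bij that by (auto simp: bij_betw_def)
      \<comment> \<open>Pulling the correlation \<open>f\<close> back to \<open>V\<close> makes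
        \<open>full\<close> applicable.\<close>
      define h where "h = d \<circ> f \<circ> e"
      have hV: "h x \<in> V" "f (e x) = e (h x)" if "x \<in> V" for x
        using fx[OF that] by (auto simp: h_def)
      have "\<exists>g \<in> carrier G. \<forall>x \<in> V. h x = act g x"
      proof (rule full)
        show "bij_betw h V V"
          unfolding h_def using be bij bd by (blast intro: bij_betw_trans)
      next
        fix x y assume xy: "x \<in> V" "y \<in> V"
        show "(x, y) \<in> E \<longleftrightarrow> (h x, h y) \<in> E"
          using f xy hV incid by (auto simp: correlations_def)
        show "\<tau> x = \<tau> y \<longleftrightarrow> \<tau> (h x) = \<tau> (h y)"
          using f xy hV typ_iff by (auto simp: correlations_def)
      qed
      then obtain g where g: "g \<in> carrier G" "\<And>x. x \<in> V \<Longrightarrow> h x = act g x" by blast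
      have "f = \<psi> g"
        by (rule extensionalityI[OF ext]) (auto simp: \<psi>_def hV g)
      then show ?thesis using g by blast
    qed
    have carr: "carrier (Aut \<Gamma>) = correlations \<Gamma>"
      by (simp add: Aut_def)
    have hom: "\<psi> \<in> hom G (Aut \<Gamma>)"
    proof (rule homI)
      fix g h assume gh: "g \<in> carrier G" "h \<in> carrier G"
      show "\<psi> (g \<otimes>\<^bsub>G\<^esub> h) = \<psi> g \<otimes>\<^bsub>Aut \<Gamma>\<^esub> \<psi> h"
      proof (rule extensionalityI[of _ "e ` V"])
        show "\<psi> g \<otimes>\<^bsub>Aut \<Gamma>\<^esub> \<psi> h \<in> extensional (e ` V)"
        proof -
          have "\<psi> g \<otimes>\<^bsub>Aut \<Gamma>\<^esub> \<psi> h \<in> correlations \<Gamma>"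
            using monoid.m_closed[OF group.is_monoid[OF group_Aut[of \<Gamma>]]] \<psi>_cor gh
            by (simp flip: carr)
          then show ?thesis
            by (simp add: correlations_def Bij_def)
        qed
        fix p assume "p \<in> e ` V"
        then show "\<psi> (g \<otimes>\<^bsub>G\<^esub> h) p = (\<psi> g \<otimes>\<^bsub>Aut \<Gamma>\<^esub> \<psi> h) p"
          using gh act_closed act_mult by (auto simp: Aut_apply(1) \<psi>_cor)
      qed (simp add: \<psi>_def)
    qed (simp add: carr \<psi>_cor)
    have "inj_on \<psi> (carrier G)"
    proof (rule inj_onI)
      fix g h assume gh: "g \<in> carrier G" "h \<in> carrier G" "\<psi> g = \<psi> h"
      have "act g x = act h x" if "x \<in> V" for x
        using e gh that act_closed \<psi>[OF that, of g] \<psi>[OF that, of h] by (auto simp: inj_on_def)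
      \<comment> \<open>Faithfulness concerns the identity only, so it is applied to the quotient of
        \<open>g\<close> and \<open>h\<close>.\<close>
      then have "inv h \<otimes>\<^bsub>G\<^esub> g = \<one>\<^bsub>G\<^esub>"
        using gh act_inv by (intro act_faithful) (auto simp: act_mult)
      then show "g = h"
        using gh by (metis inv_equality inv_inv inv_closed)
    qed
    then have iso: "\<psi> \<in> iso G (Aut \<Gamma>)"
      using hom surj \<psi>_cor by (auto simp: iso_def bij_betw_def carr)
    have aut: "\<psi> g \<in> automorphisms \<Gamma> \<longleftrightarrow> g \<in> H" if g: "g \<in> carrier G" for g
      using act_kernel[OF g] \<psi>_cor[OF g] act_closed[OF g]
      by (auto simp: automorphisms_def typ_iff)
    have "\<psi> ` H = automorphisms \<Gamma>"
    proof
      show "\<psi> ` H \<subseteq> automorphisms \<Gamma>"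
        using aut \<open>H \<subseteq> carrier G\<close> by blast
      show "automorphisms \<Gamma> \<subseteq> \<psi> ` H"
      proof
        fix f assume f: "f \<in> automorphisms \<Gamma>"
        then obtain g where "g \<in> carrier G" "f = \<psi> g"
          using surj by (auto simp: automorphisms_def)
        then show "f \<in> \<psi> ` H" using aut f by blast
      qed
    qed
    \<comment> \<open>The isomorphism \<open>\<psi>\<close> leads from \<open>G\<close> to
      \<open>Aut \<Gamma>\<close>; the claim asks for its inverse.\<close>
    then have "inv_into (carrier G) \<psi> ` automorphisms \<Gamma> = H"
      using \<open>inj_on \<psi> (carrier G)\<close> \<open>H \<subseteq> carrier G\<close> by (metis inv_into_image_cancel)
    then show ?thesis
      using iso_set_sym[OF iso] by blast
  qed
  ultimately show ?thesis by blast
qed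


section \<open>The graph\<close>

text \<open>An arc has its tail in \<open>B\<close> and its head in \<open>C\<close>. This records
  its direction and keeps its two ends distinct even for the label \<open>\<one>\<close>.\<close>

datatype 'a vertex = B 'a | C 'a | W nat | U 'a 'a

locale rigid_graph = normal H G for H and G (structure) +
  fixes ix :: "'a \<Rightarrow> nat" and n :: nat
  assumes ix: "bij_betw ix (carrier G) {..<n}"
    and n: "1 < n"
begin

text \<open>The index of \<open>W\<close> starts at 1: a vertex \<open>W 0\<close> would be adjacent
  to every \<open>U g a\<close>, and the class of \<open>C\<close> and \<open>W\<close> would grow
  to \<open>2 n\<close>, which equals \<open>n * n\<close> for \<open>n = 2\<close>.\<close>

definition V :: "'a vertex set" where
  "V = B ` carrier G \<union> C ` carrier G \<union> W ` {1..<n} \<union> case_prod U ` (carrier G \<times> carrier G)"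

lemma V_simps [simp]:
  "B g \<in> V \<longleftrightarrow> g \<in> carrier G"
  "C g \<in> V \<longleftrightarrow> g \<in> carrier G"
  "W j \<in> V \<longleftrightarrow> 1 \<le> j \<and> j < n"
  "U g a \<in> V \<longleftrightarrow> g \<in> carrier G \<and> a \<in> carrier G"
  by (auto simp: V_def)

fun arc :: "'a vertex \<Rightarrow> 'a vertex \<Rightarrow> bool" where
  "arc (U g a) (B h) \<longleftrightarrow> h = g"
| "arc (U g a) (C h) \<longleftrightarrow> h = g \<otimes> a"
| "arc (U g a) (W j) \<longleftrightarrow> j \<le> ix a"
| "arc _ _ \<longleftrightarrow> False"

definition E :: "'a vertex rel" where
  "E = {(x, y). x \<in> V \<and> y \<in> V \<and> (arc x y \<or> arc y x)}"

text \<open>As \<open>H\<close> is normal, left translations permute its right cosets, and the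
  elements of \<open>H\<close> are those fixing every coset. \<open>C\<close> and \<open>W\<close>
  share a type since \<open>C\<close> alone would form a class of size \<open>n\<close>, like
  \<open>B\<close> in the case that \<open>H\<close> is all of \<open>G\<close>.\<close>

fun \<tau> :: "'a vertex \<Rightarrow> 'a set + bool" where
  "\<tau> (B g) = Inl (H #> g)"
| "\<tau> (C g) = Inr True"
| "\<tau> (W j) = Inr True"
| "\<tau> (U g a) = Inr False"

text \<open>Left translation commutes with right multiplication by labels, so arcs go to arcs with
  the same label.\<close>

fun act :: "'a \<Rightarrow> 'a vertex \<Rightarrow> 'a vertex" where
  "act x (B g) = B (x \<otimes> g)"
| "act x (C g) = C (x \<otimes> g)"
| "act x (W j) = W j"
| "act x (U g a) = U (x \<otimes> g) a"

section \<open>Neighbourhoods and degrees\<close>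

lemma card_carrier: "card (carrier G) = n" and finite_carrier: "finite (carrier G)"
  using ix bij_betw_same_card bij_betw_finite by fastforce+

lemma ix_less: "a \<in> carrier G \<Longrightarrow> ix a < n"
  using ix by (auto simp: bij_betw_def)

lemma ix_surj: "j < n \<Longrightarrow> \<exists>a \<in> carrier G. ix a = j"
  using ix unfolding bij_betw_def by (metis imageE lessThan_iff)

lemma finite_V: "finite V"
  using finite_carrier by (simp add: V_def)

lemma E_iff: "(x, y) \<in> E \<longleftrightarrow> x \<in> V \<and> y \<in> V \<and> (arc x y \<or> arc y x)"
  by (simp add: E_def)

lemma nbrs_U:
  assumes "g \<in> carrier G" "a \<in> carrier G"
  shows "E `` {U g a} = {B g, C (g \<otimes> a)} \<union> W ` {1..ix a}"
proof (intro Set.set_eqI)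
  fix y show "y \<in> E `` {U g a} \<longleftrightarrow> y \<in> {B g, C (g \<otimes> a)} \<union> W ` {1..ix a}"
    using assms ix_less[of a] by (cases y) (auto simp: E_iff)
qed

text \<open>Since \<open>ix\<close> is injective on the group, this degree determines the label
  \<open>a\<close>.\<close>

lemma degree_U:
  assumes "g \<in> carrier G" "a \<in> carrier G"
  shows "card (E `` {U g a}) = 2 + ix a"
proof -
  have "card ({B g, C (g \<otimes> a)} \<union> W ` {1..ix a}) = card {B g, C (g \<otimes> a)} + card (W ` {1..ix a} :: 'a vertex set)"
    by (subst Finite_Set.card_Un_disjoint) auto
  then show ?thesis
    by (simp add: nbrs_U[OF assms] card_image inj_on_def)
qed

lemma degree_ge_2:
  assumes x: "x \<in> V"
  shows "2 \<le> card (E `` {x})"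
proof -
  \<comment> \<open>Each vertex other than a \<open>U\<close> has at least \<open>n\<close>
    neighbours, exhibited by an injection \<open>p\<close> of the group.\<close>
  have many: "2 \<le> card (E `` {x})" if "inj_on p (carrier G)" "p ` carrier G \<subseteq> E `` {x}" for p
  proof -
    have "finite (E `` {x})"
      by (rule finite_subset[OF _ finite_V]) (auto simp: E_iff)
    then show ?thesis
      using card_inj_on_le[OF that] card_carrier n by simp
  qed
  show ?thesis
  proof (cases x)
    case (B g)
    then show ?thesis using x by (intro many[of "U g"]) (auto simp: inj_on_def E_iff)
  next
    case (C g)
    then show ?thesis using x
      \<comment> \<open>For each label \<open>a\<close>, exactly one arc with that label ends at
        \<open>g\<close>; it starts at \<open>g \<otimes> inv a\<close>.\<close>
      by (intro many[of "\<lambda>a. U (g \<otimes> inv a) a"]) (auto simp: inj_on_def E_iff m_assoc)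
  next
    case (W j)
    then obtain a where "a \<in> carrier G" "ix a = j"
      using ix_surj[of j] x by auto
    then show ?thesis using x W by (intro many[of "\<lambda>g. U g a"]) (auto simp: inj_on_def E_iff)
  next
    case (U g a)
    then show ?thesis using x by (simp add: degree_U)
  qed
qed

section \<open>Translations and cosets\<close>

lemma rcos_translate:
  assumes "x \<in> carrier G" "g \<in> carrier G" "h \<in> carrier G" "H #> g = H #> h"
  shows "H #> (x \<otimes> g) = H #> (x \<otimes> h)"
proof -
  \<comment> \<open>Normality lets \<open>x\<close> pass to the left of \<open>H\<close>.\<close>
  have "H #> (x \<otimes> k) = x <# (H #> k)" if "k \<in> carrier G" for k
    using that assms(1) coset_eq by (metis coset_assoc coset_mult_assoc subset)
  then show ?thesis using assms by simp
qed

text \<open>The type of \<open>B \<one>\<close> detects membership in \<open>H\<close>; conversely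
  \<open>H\<close> absorbs \<open>x\<close> on the left of every \<open>g\<close>.\<close>

lemma fixes_types_iff:
  assumes x: "x \<in> carrier G"
  shows "(\<forall>v \<in> V. \<tau> (act x v) = \<tau> v) \<longleftrightarrow> x \<in> H"
proof
  assume "\<forall>v \<in> V. \<tau> (act x v) = \<tau> v"
  then have "\<tau> (act x (B \<one>)) = \<tau> (B \<one>)"
    by (metis V_simps(1) one_closed)
  then have "H #> x = H"
    using x subset by simp
  then show "x \<in> H"
    using x rcos_self[OF x] by (metis is_subgroup)
next
  assume H: "x \<in> H"
  show "\<forall>v \<in> V. \<tau> (act x v) = \<tau> v"
  proof
    fix v assume v: "v \<in> V"
    have "H #> (x \<otimes> g) = H #> g" if "g \<in> carrier G" for g
      using that x H by (metis coset_join2 coset_mult_assoc is_subgroup subset)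
    then show "\<tau> (act x v) = \<tau> v"
      using v by (cases v) auto
  qed
qed

section \<open>Rigidity: type classes and correlations\<close>

lemma class_U: "{y \<in> V. \<tau> y = Inr False} = case_prod U ` (carrier G \<times> carrier G)"
proof (intro Set.set_eqI)
  fix y show "y \<in> {y \<in> V. \<tau> y = Inr False} \<longleftrightarrow> y \<in> case_prod U ` (carrier G \<times> carrier G)"
    by (cases y) auto
qed

lemma class_CW: "{y \<in> V. \<tau> y = Inr True} = C ` carrier G \<union> W ` {1..<n}"
proof (intro Set.set_eqI)
  fix y show "y \<in> {y \<in> V. \<tau> y = Inr True} \<longleftrightarrow> y \<in> C ` carrier G \<union> W ` {1..<n}"
    by (cases y) auto
qed

lemma card_class_U: "card {y \<in> V. \<tau> y = Inr False} = n * n"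
  by (simp add: class_U card_image inj_on_def card_cartesian_product card_carrier)

lemma card_class_CW: "card {y \<in> V. \<tau> y = Inr True} = n + (n - 1)"
proof -
  have "card (C ` carrier G \<union> W ` {1..<n}) = card (C ` carrier G) + card (W ` {1..<n} :: 'a vertex set)"
    using finite_carrier by (subst Finite_Set.card_Un_disjoint) auto
  then show ?thesis
    by (simp add: class_CW card_image inj_on_def card_carrier)
qed

lemma card_class_B: "card {y \<in> V. \<tau> y = Inl K} \<le> n"
proof -
  have "y \<in> B ` carrier G" if "y \<in> V" "\<tau> y = Inl K" for y
    using that by (cases y) auto
  then have "{y \<in> V. \<tau> y = Inl K} \<subseteq> B ` carrier G" by blast
  then have "card {y \<in> V. \<tau> y = Inl K} \<le> card (B ` carrier G)"
    using finite_carrier by (intro card_mono) auto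
  then show ?thesis by (simp add: card_image inj_on_def card_carrier)
qed

text \<open>Class sizes recover the kinds up to confusing \<open>C\<close> with \<open>W\<close>,
  and degrees recover the labels. Incidences then determine the map from its value at
  \<open>B \<one>\<close>.\<close>

lemma correlation_is_translation:
  assumes bij: "bij_betw f V V"
    and fE: "\<And>x y. \<lbrakk>x \<in> V; y \<in> V\<rbrakk> \<Longrightarrow> (x, y) \<in> E \<longleftrightarrow> (f x, f y) \<in> E"
    and f\<tau>: "\<And>x y. \<lbrakk>x \<in> V; y \<in> V\<rbrakk> \<Longrightarrow> \<tau> x = \<tau> y \<longleftrightarrow> \<tau> (f x) = \<tau> (f y)"
  shows "\<exists>g \<in> carrier G. \<forall>x \<in> V. f x = act g x"
proof -
  have fV: "f x \<in> V" if "x \<in> V" for x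
    using bij that by (auto simp: bij_betw_def)
  have inj: "inj_on f V" and img: "f ` V = V"
    using bij by (auto simp: bij_betw_def)
  \<comment> \<open>A correlation maps each type class onto a type class, so class sizes are
    invariants.\<close>
  have class_card: "card {y \<in> V. \<tau> y = \<tau> (f x)} = card {y \<in> V. \<tau> y = \<tau> x}" if x: "x \<in> V" for x
  proof -
    have "f ` {y \<in> V. \<tau> y = \<tau> x} = {y \<in> V. \<tau> y = \<tau> (f x)}"
    proof (intro Set.set_eqI iffI)
      fix z assume z: "z \<in> {y \<in> V. \<tau> y = \<tau> (f x)}"
      then obtain y where "y \<in> V" "z = f y" using img by blast
      then show "z \<in> f ` {y \<in> V. \<tau> y = \<tau> x}" using z f\<tau> x by auto
    qed (use f\<tau> x fV in auto)
    moreover have "card (f ` {y \<in> V. \<tau> y = \<tau> x}) = card {y \<in> V. \<tau> y = \<tau> x}"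
      by (intro card_image inj_on_subset[OF inj]) auto
    ultimately show ?thesis by simp
  qed
  have degree: "card (E `` {f x}) = card (E `` {x})" if x: "x \<in> V" for x
  proof -
    have "f ` (E `` {x}) = E `` {f x}"
    proof (intro Set.set_eqI iffI)
      fix z assume z: "z \<in> E `` {f x}"
      then have "z \<in> V" by (simp add: E_iff)
      then obtain y where y: "y \<in> V" "z = f y" using img by blast
      then have "(x, y) \<in> E" using z fE[OF x y(1)] by simp
      then show "z \<in> f ` (E `` {x})" using y by blast
    next
      fix z assume "z \<in> f ` (E `` {x})"
      then obtain y where y: "(x, y) \<in> E" "z = f y" by blast
      then have "y \<in> V" by (simp add: E_iff)
      then show "z \<in> E `` {f x}" using y fE[OF x] by blast
    qed
    moreover have "card (f ` (E `` {x})) = card (E `` {x})"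
      by (intro card_image inj_on_subset[OF inj]) (auto simp: E_iff)
    ultimately show ?thesis by simp
  qed
  have sizes: "n < n + (n - 1)" "n + (n - 1) < n * n"
  proof -
    obtain m where "n = Suc (Suc m)" using less_imp_Suc_add[OF n] by auto
    then show "n < n + (n - 1)" "n + (n - 1) < n * n" by simp_all
  qed
  have kind_B: "\<exists>h \<in> carrier G. f (B g) = B h" if g: "g \<in> carrier G" for g
    using class_card[of "B g"] fV[of "B g"] g sizes card_class_B[of "H #> g"]
    by (cases "f (B g)") (auto simp: card_class_U card_class_CW)
  have kind_U: "\<exists>h \<in> carrier G. f (U g a) = U h a" if ga: "g \<in> carrier G" "a \<in> carrier G" for g a
  proof -
    have "\<exists>h b. f (U g a) = U h b"
    proof (cases "f (U g a)")
      case (B h)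
      then show ?thesis
        using class_card[of "U g a"] ga sizes card_class_B[of "H #> h"]
        by (simp add: card_class_U)
    qed (use class_card[of "U g a"] ga sizes in \<open>auto simp: card_class_U card_class_CW\<close>)
    then obtain h b where h: "f (U g a) = U h b" by blast
    then have hb: "h \<in> carrier G" "b \<in> carrier G"
      using fV[of "U g a"] ga by auto
    \<comment> \<open>Equal degrees \<open>2 + ix a\<close> and \<open>2 + ix b\<close> force equal
      labels.\<close>
    have "ix a = ix b"
      using degree[of "U g a"] ga hb h by (simp add: degree_U)
    then have "a = b"
      using ix ga hb by (auto simp: bij_betw_def inj_on_def)
    then show ?thesis using h hb by blast
  qed
  have kind_CW: "(\<exists>h \<in> carrier G. f x = C h) \<or> (\<exists>k. 1 \<le> k \<and> k < n \<and> f x = W k)"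
    if x: "x \<in> V" "\<tau> x = Inr True" for x
  proof (cases "f x")
    case (B h)
    then show ?thesis
      using class_card[OF x(1)] x sizes card_class_B[of "H #> h"] by (simp add: card_class_CW)
  qed (use class_card[OF x(1)] x sizes fV[OF x(1)] in \<open>auto simp: card_class_U card_class_CW\<close>)
  \<comment> \<open>The map induced on the copy \<open>B\<close>; it will turn out to be a left
    translation.\<close>
  obtain \<phi> where \<phi>: "\<And>g. g \<in> carrier G \<Longrightarrow> \<phi> g \<in> carrier G \<and> f (B g) = B (\<phi> g)"
    using kind_B by metis
  have fU: "f (U g a) = U (\<phi> g) a" if ga: "g \<in> carrier G" "a \<in> carrier G" for g a
  proof -
    obtain h where h: "h \<in> carrier G" "f (U g a) = U h a"
      using kind_U[OF ga] by blast
    \<comment> \<open>\<open>B h\<close> is the only neighbour of \<open>U h a\<close> of kind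
      \<open>B\<close>, so following this edge identifies \<open>h\<close>.\<close>
    have "(U g a, B g) \<in> E"
      using ga by (simp add: E_iff)
    then have "(U h a, B (\<phi> g)) \<in> E"
      using fE[of "U g a" "B g"] ga h \<phi>[OF ga(1)] by simp
    then show ?thesis using h by (simp add: E_iff)
  qed
  have kind_C: "\<exists>h \<in> carrier G. f (C g) = C h" if g: "g \<in> carrier G" for g
  proof -
    \<comment> \<open>Arcs whose label has number 0 have no neighbour \<open>W k\<close>. As
      \<open>C g\<close> ends such an arc, its image cannot be a \<open>W\<close>.\<close>
    obtain a where a: "a \<in> carrier G" "ix a = 0"
      using ix_surj[of 0] n by auto
    have "(U (g \<otimes> inv a) a, C g) \<in> E"
      using a g by (simp add: E_iff m_assoc)
    then have "(U (\<phi> (g \<otimes> inv a)) a, f (C g)) \<in> E"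
      using fE[of "U (g \<otimes> inv a) a" "C g"] a g fU by simp
    then show ?thesis
      using kind_CW[of "C g"] g a by (auto simp: E_iff)
  qed
  have fC: "f (C (g \<otimes> a)) = C (\<phi> g \<otimes> a)" if ga: "g \<in> carrier G" "a \<in> carrier G" for g a
  proof -
    obtain h where h: "h \<in> carrier G" "f (C (g \<otimes> a)) = C h"
      using kind_C[of "g \<otimes> a"] ga by blast
    have "(U g a, C (g \<otimes> a)) \<in> E"
      using ga by (simp add: E_iff)
    then have "(U (\<phi> g) a, C h) \<in> E"
      using fE[of "U g a" "C (g \<otimes> a)"] ga h fU by simp
    then show ?thesis using h by (simp add: E_iff)
  qed
  define t where "t = \<phi> \<one>"
  have t: "t \<in> carrier G" using \<phi> by (simp add: t_def)
  have fC': "f (C g) = C (t \<otimes> g)" if "g \<in> carrier G" for g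
    using fC[of \<one> g] that by (simp add: t_def)
  \<comment> \<open>\<open>f (C g)\<close> is computed twice: along the arc from
    \<open>\<one>\<close> with label \<open>g\<close>, and along the arc from \<open>g\<close> with
    label \<open>\<one>\<close>.\<close>
  have \<phi>_eq: "\<phi> g = t \<otimes> g" if g: "g \<in> carrier G" for g
    using fC[of g \<one>] fC'[OF g] g \<phi>[OF g] by simp
  have fW: "f (W j) = W j" if j: "1 \<le> j" "j < n" for j
  proof -
    \<comment> \<open>Every \<open>C h\<close> is already the image of some \<open>C\<close>, so
      injectivity leaves only a \<open>W\<close> for \<open>W j\<close>.\<close>
    have "f (W j) \<noteq> C h" if h: "h \<in> carrier G" for h
    proof
      assume "f (W j) = C h"
      also have "C h = f (C (inv t \<otimes> h))"
        using h t by (simp add: fC' m_assoc[symmetric])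
      finally have "W j = C (inv t \<otimes> h)"
        by (rule inj_onD[OF inj]) (use j h t in auto)
      then show False by simp
    qed
    then obtain k where k: "1 \<le> k" "k < n" "f (W j) = W k"
      using kind_CW[of "W j"] j by auto
    \<comment> \<open>The labels adjacent to \<open>W j\<close> and to its image agree; testing the
      labels numbered \<open>j\<close> and \<open>k\<close> gives \<open>j = k\<close>.\<close>
    have *: "j \<le> ix a \<longleftrightarrow> k \<le> ix a" if a: "a \<in> carrier G" for a
    proof -
      have "(U \<one> a, W j) \<in> E \<longleftrightarrow> (U t a, W k) \<in> E"
        using fE[of "U \<one> a" "W j"] a j k fU[of \<one> a] by (simp add: t_def)
      then show ?thesis using a j k t by (simp add: E_iff)
    qed
    obtain a b where "a \<in> carrier G" "ix a = j" "b \<in> carrier G" "ix b = k"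
      using ix_surj j k by metis
    then have "j = k" using *[of a] *[of b] by simp
    then show ?thesis using k by simp
  qed
  have "f x = act t x" if "x \<in> V" for x
    using that by (cases x) (auto simp: \<phi> \<phi>_eq fU fC' fW)
  then show ?thesis using t by blast
qed

section \<open>Translations as symmetries and the resulting system\<close>

lemma arc_act:
  assumes "g \<in> carrier G" "x \<in> V" "y \<in> V" "arc x y"
  shows "arc (act g x) (act g y)"
  using assms by (cases x; cases y) (auto simp: m_assoc)

lemma realization:
  "\<exists>\<Gamma> :: (nat, nat) inc_system.
    finite_incidence_system \<Gamma> \<and>
    (\<forall>v \<in> elems \<Gamma>. vertex_degree (incidence_edges \<Gamma>) v \<ge> 2) \<and>
    (\<forall>K \<subseteq> elems \<Gamma>. clique K (incidence_edges \<Gamma>) \<longrightarrow> card K \<le> 2) \<and>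
    (\<exists>\<phi> \<in> iso (Aut \<Gamma>) G. \<phi> ` automorphisms \<Gamma> = H)"
proof (rule realize_action[where V = V and E = E and \<tau> = \<tau> and act = act])
  show "V \<noteq> {}"
    using V_simps(1)[of \<one>] by blast
  show "E \<subseteq> V \<times> V" "sym E"
    by (auto simp: E_iff sym_def)
  show act_V: "act g x \<in> V" if "g \<in> carrier G" "x \<in> V" for g x
    using that by (cases x) auto
  show "\<tau> x \<noteq> \<tau> y" if "(x, y) \<in> E" for x y
    using that by (cases x; cases y) (auto simp: E_iff)
  \<comment> \<open>Every edge joins a \<open>U\<close> to a vertex of another kind, so the graph is
    bipartite.\<close>
  show False if "(x, y) \<in> E" "(y, z) \<in> E" "(x, z) \<in> E" for x y z
    using that by (cases x; cases y; cases z) (auto simp: E_iff)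
  show "act \<one> x = x" if "x \<in> V" for x
    using that by (cases x) auto
  show "act (g \<otimes> h) x = act g (act h x)"
    if "g \<in> carrier G" "h \<in> carrier G" "x \<in> V" for g h x
    using that by (cases x) (auto simp: m_assoc)
  show "g = \<one>" if "g \<in> carrier G" "\<forall>x \<in> V. act g x = x" for g
    using that(1) bspec[OF that(2), of "B \<one>"] by simp
  show "(act g x, act g y) \<in> E" if "g \<in> carrier G" "(x, y) \<in> E" for g x y
    using that arc_act act_V unfolding E_iff by blast
  show "\<tau> (act g x) = \<tau> (act g y)"
    if "g \<in> carrier G" "x \<in> V" "y \<in> V" "\<tau> x = \<tau> y" for g x y
    using that by (cases x; cases y) (simp_all, metis rcos_translate)
qed (fact is_group finite_V degree_ge_2 fixes_types_iff subset
    | rule correlation_is_translation; assumption)+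

end

theorem theorem3p1:
  fixes G :: "('a, 'b) monoid_scheme" and H :: "'a set"
  assumes "group G"
    and "finite (carrier G)"
    and "carrier G \<noteq> {\<one>\<^bsub>G\<^esub>}"
    and "H \<lhd> G"
  shows "\<exists>\<Gamma> :: (nat, nat) inc_system.
    finite_incidence_system \<Gamma> \<and>
    (\<forall>v \<in> elems \<Gamma>. vertex_degree (incidence_edges \<Gamma>) v \<ge> 2) \<and>
    (\<forall>K \<subseteq> elems \<Gamma>. clique K (incidence_edges \<Gamma>) \<longrightarrow> card K \<le> 2) \<and>
    (\<exists>\<phi> \<in> iso (Aut \<Gamma>) G. \<phi> ` automorphisms \<Gamma> = H)"
proof -
  interpret group G by fact
  \<comment> \<open>Any numbering of the group serves; non-triviality provides \<open>1 < n\<close>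
    for \<open>n = order G\<close>.\<close>
  obtain ix :: "'a \<Rightarrow> nat" where ix: "bij_betw ix (carrier G) {..<order G}"
    using ex_bij_betw_finite_nat[OF assms(2)] by (auto simp: atLeast0LessThan order_def)
  have "order G \<noteq> 1" "0 < order G"
    using assms(2,3) order_gt_0_iff_finite order_one_triv_iff by auto
  then have "1 < order G" by linarith
  then interpret rigid_graph H G ix "order G"
    using assms(4) ix by (simp add: rigid_graph_def rigid_graph_axioms_def)
  show ?thesis by (rule realization)
qed

end
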